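(* Let $\mathbb{F}\in\{\mathbb{R},\mathbb{C}\}$, $d\geq 1$, $H=\mathbb{F}^d$. For every formula $\varphi$, $\mathrm{Sat}_{\mathrm{PBA}}^d(\varphi) \Longrightarrow \mathrm{Sat}_{\mathrm{STD}}^d(\varphi)$.
   Context: $H=\mathbb{F}^d$ with standard inner product; $L(H)$ is the set of linear subspaces of $H$ and $\mathrm{Proj}(H)$ the set of orthogonal projectors. Formulas are built from atoms $p_0,p_1,\dots$ by $\varphi ::= p_i \mid \neg\varphi \mid (\varphi\wedge\psi)\mid(\varphi\vee\psi)$. STD semantics: a standard valuation is a map $v$ from atoms to $L(H)$; $[\![p_i]\!]=v(p_i)$, $[\![\neg\varphi]\!]=[\![\varphi]\!]^\perp$, $[\![\varphi\wedge\psi]\!]=[\![\varphi]\!]\cap[\![\psi]\!]$, $[\![\varphi\vee\psi]\!]=[\![\varphi]\!]+[\![\psi]\!]$. $\mathrm{Sat}_{\mathrm{STD}}^d(\varphi)$: some standard valuation gives $[\![\varphi]\!]\neq\{0\}$. PBA semantics: for a projector valuation $v$ (atoms $\to\mathrm{Proj}(H)$), values are defined recursively and partially: atoms get $v(p_i)$; $[\![\neg\theta]\!]=I-[\![\theta]\!]$ if $[\![\theta]\!]$ defined; $[\![\alpha\wedge\beta]\!]=[\![\alpha]\!][\![\beta]\!]$ and $[\![\alpha\vee\beta]\!]=[\![\alpha]\!]+[\![\beta]\!]-[\![\alpha]\!][\![\beta]\!]$, each defined only if $[\![\alpha]\!],[\![\beta]\!]$ are defined and commute. $\mathrm{Sat}_{\mathrm{PBA}}^d(\varphi)$: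 some projector valuation makes $[\![\varphi]\!]^{\mathrm{PBA}}_v$ defined and nonzero. *)

theory Defs
  imports "HOL-Analysis.Analysis" "Jordan_Normal_Form.Conjugate"
begin

datatype form =
    Atom nat
  | Neg form
  | Conj form form
  | Disj form form

text \<open>The scalar type \<^typ>\<open>'a\<close> is meant to be \<^typ>\<open>real\<close> (where \<^const>\<open>conjugate\<close> is the
  identity) or \<^typ>\<open>complex\<close> (where it is \<^const>\<open>cnj\<close>). The library's inner product on
  \<^typ>\<open>complex ^ 'd\<close> is the real-valued one, hence the explicit definition here.\<close>

definition std_inner :: "'a::conjugatable_field ^ 'd \<Rightarrow> 'a ^ 'd \<Rightarrow> 'a" where
  "std_inner x y = (\<Sum>i\<in>UNIV. x $ i * conjugate (y $ i))"

definition orth_compl :: "('a::conjugatable_field ^ 'd) set \<Rightarrow> ('a ^ 'd) set" where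
  "orth_compl U = {x. \<forall>y\<in>U. std_inner x y = 0}"

text \<open>\<^const>\<open>vec.subspace\<close> is about subspaces over the scalar field \<^typ>\<open>'a\<close>, whereas
  \<^const>\<open>subspace\<close> would be about real subspaces.\<close>

definition std_valuation :: "(nat \<Rightarrow> ('a::field ^ 'd) set) \<Rightarrow> bool" where
  "std_valuation v \<longleftrightarrow> (\<forall>i. vec.subspace (v i))"

primrec std_value ::
  "(nat \<Rightarrow> ('a::conjugatable_field ^ 'd) set) \<Rightarrow> form \<Rightarrow> ('a ^ 'd) set" where
  "std_value v (Atom i) = v i"
| "std_value v (Neg \<phi>) = orth_compl (std_value v \<phi>)"
| "std_value v (Conj \<phi> \<psi>) = std_value v \<phi> \<inter> std_value v \<psi>"
| "std_value v (Disj \<phi> \<psi>) = {x + y | x y. x \<in> std_value v \<phi> \<and> y \<in> std_value v \<psi>}"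

text \<open>The type argument fixes the space $H = F^d$, so $d$ is \<^term>\<open>CARD('d)\<close>.\<close>

definition sat_std :: "('a::conjugatable_field ^ 'd) itself \<Rightarrow> form \<Rightarrow> bool" where
  "sat_std _ \<phi> \<longleftrightarrow>
     (\<exists>v :: nat \<Rightarrow> ('a ^ 'd) set. std_valuation v \<and> std_value v \<phi> \<noteq> {0})"

text \<open>Operators on $F^d$ are represented by their matrices with respect to the standard basis.\<close>

definition orth_projector :: "'a::conjugatable_field ^ 'd ^ 'd \<Rightarrow> bool" where
  "orth_projector P \<longleftrightarrow>
     P ** P = P \<and> (\<forall>x y. std_inner (P *v x) y = std_inner x (P *v y))"

definition proj_valuation :: "(nat \<Rightarrow> 'a::conjugatable_field ^ 'd ^ 'd) \<Rightarrow> bool" where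
  "proj_valuation v \<longleftrightarrow> (\<forall>i. orth_projector (v i))"

text \<open>\<^const>\<open>None\<close> stands for an undefined value.\<close>

primrec pba_value ::
  "(nat \<Rightarrow> 'a::field ^ 'd ^ 'd) \<Rightarrow> form \<Rightarrow> ('a ^ 'd ^ 'd) option" where
  "pba_value v (Atom i) = Some (v i)"
| "pba_value v (Neg \<phi>) =
     (case pba_value v \<phi> of Some A \<Rightarrow> Some (mat 1 - A) | None \<Rightarrow> None)"
| "pba_value v (Conj \<phi> \<psi>) =
     (case (pba_value v \<phi>, pba_value v \<psi>) of
        (Some A, Some B) \<Rightarrow> if A ** B = B ** A then Some (A ** B) else None
      | _ \<Rightarrow> None)"
| "pba_value v (Disj \<phi> \<psi>) =
     (case (pba_value v \<phi>, pba_value v \<psi>) of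
        (Some A, Some B) \<Rightarrow> if A ** B = B ** A then Some (A + B - A ** B) else None
      | _ \<Rightarrow> None)"

definition sat_pba :: "('a::conjugatable_field ^ 'd) itself \<Rightarrow> form \<Rightarrow> bool" where
  "sat_pba _ \<phi> \<longleftrightarrow>
     (\<exists>v :: nat \<Rightarrow> 'a ^ 'd ^ 'd. proj_valuation v \<and> (\<exists>A. pba_value v \<phi> = Some A \<and> A \<noteq> 0))"

end

theory Submission
  imports Defs
begin

text \<open>Where it is defined, the PBA value of a formula is an orthogonal projector, and its
  range is the STD value under the valuation sending each atom to the range of its projector:
  for commuting projectors the meet and join of the ranges are the ranges of
  \<open>A B\<close> and \<open>A + B - A B\<close>.\<close>

text \<open>Multiplicativity makes \<open>conjugate 1\<close> a nonzero idempotent of a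
  field.\<close>

lemma conjugate_one: "conjugate (1 :: 'a::conjugatable_field) = 1"
proof -
  have "conjugate (1::'a) * conjugate 1 = conjugate 1"
    by (simp flip: conjugate_dist_mul)
  moreover have "conjugate (1::'a) \<noteq> 0"
    by simp
  ultimately show ?thesis by simp
qed

lemma std_inner_axis:
  fixes x :: "'a::conjugatable_field ^ 'd"
  shows "std_inner x (axis i 1) = x $ i"
proof -
  have "std_inner x (axis i 1) = (\<Sum>j\<in>UNIV. if j = i then x $ j else 0)"
    unfolding std_inner_def axis_def
    by (rule sum.cong) (auto simp: conjugate_one)
  then show ?thesis by simp
qed

text \<open>Nondegeneracy comes from testing against the \<open>axis\<close> vectors, which read off
  the coordinates. Positivity of the inner product does not enter, so any conjugatable field will
  do.\<close>

lemma std_inner_eq_zero_iff: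
  fixes x :: "'a::conjugatable_field ^ 'd"
  shows "(\<forall>y. std_inner x y = 0) \<longleftrightarrow> x = 0"
proof
  assume "\<forall>y. std_inner x y = 0"
  then show "x = 0"
    by (metis std_inner_axis vec_eq_iff zero_index)
qed (simp add: std_inner_def)

lemma std_inner_diff_left: "std_inner (x - y) z = std_inner x z - std_inner y z"
  by (simp add: std_inner_def algebra_simps sum_subtractf)

lemma std_inner_diff_right:
  fixes x :: "'a::conjugatable_field ^ 'd"
  shows "std_inner x (y - z) = std_inner x y - std_inner x z"
proof -
  have "conjugate (a - b) = conjugate a - conjugate b" for a b :: 'a
    using conjugate_dist_add[of a "- b"] by (simp add: conjugate_neg)
  then show ?thesis
    by (simp add: std_inner_def right_diff_distrib sum_subtractf)
qed

text \<open>For an idempotent \<open>A\<close> this is the range of \<open>A\<close>; in the form of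
  fixed vectors, membership is an equation instead of an existential.\<close>

definition fixed_space :: "'a::field ^ 'd ^ 'd \<Rightarrow> ('a ^ 'd) set" where
  "fixed_space A = {x. A *v x = x}"

lemma subspace_fixed_space: "vec.subspace (fixed_space A)"
  by (auto simp: fixed_space_def vec.subspace_def matrix_vector_right_distrib
      vector_scalar_commute)

lemma fixed_space_eq_zero_iff:
  assumes "A ** A = A"
  shows "fixed_space A = {0} \<longleftrightarrow> A = 0"
proof
  assume fixed: "fixed_space A = {0}"
  have "A *v y \<in> fixed_space A" for y
    using assms by (simp add: fixed_space_def matrix_vector_mul_assoc)
  with fixed show "A = 0"
    by (simp add: matrix_eq)
qed (auto simp: fixed_space_def)

lemma orth_projector_compl:
  assumes "orth_projector A"
  shows "orth_projector (mat 1 - A)"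
proof -
  have "A *v (A *v x) = A *v x" for x
    using assms by (simp add: orth_projector_def matrix_vector_mul_assoc)
  then have "(mat 1 - A) ** (mat 1 - A) = mat 1 - A"
    by (simp add: matrix_eq matrix_vector_mult_diff_rdistrib matrix_vector_mult_diff_distrib
        flip: matrix_vector_mul_assoc)
  with assms show ?thesis
    by (simp add: orth_projector_def matrix_vector_mult_diff_rdistrib
        std_inner_diff_left std_inner_diff_right)
qed

lemma orth_projector_mult:
  assumes "orth_projector A" "orth_projector B" and comm: "A ** B = B ** A"
  shows "orth_projector (A ** B)"
proof -
  have "(A ** B) ** (A ** B) = A ** (B ** A) ** B"
    by (simp add: matrix_mul_assoc)
  also have "\<dots> = (A ** A) ** (B ** B)"
    by (simp add: matrix_mul_assoc flip: comm)
  finally have "(A ** B) ** (A ** B) = A ** B"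
    using assms by (simp add: orth_projector_def)
  moreover have "std_inner ((A ** B) *v x) y = std_inner x ((A ** B) *v y)" for x y
    using assms(1,2) unfolding orth_projector_def
    \<comment> \<open>Moving \<open>A\<close> and then \<open>B\<close> across the inner product
      produces \<open>B ** A\<close> on the right, so only the right-hand occurrence of
      \<open>A ** B\<close> is swapped.\<close>
    by (subst (2) comm) (simp flip: matrix_vector_mul_assoc)
  ultimately show ?thesis
    by (simp add: orth_projector_def)
qed

text \<open>De Morgan: the join is \<open>mat 1 - (mat 1 - A) ** (mat 1 - B)\<close>, which reduces
  the claim to complements and commuting products.\<close>

lemma orth_projector_join:
  assumes "orth_projector A" "orth_projector B" and comm: "A ** B = B ** A"
  shows "orth_projector (A + B - A ** B)"
proof -
  have comm': "A *v (B *v x) = B *v (A *v x)" for x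
    by (simp add: matrix_vector_mul_assoc comm)
  have "(mat 1 - A) ** (mat 1 - B) = (mat 1 - B) ** (mat 1 - A)"
    by (simp add: matrix_eq matrix_vector_mult_diff_rdistrib matrix_vector_mult_diff_distrib comm'
        flip: matrix_vector_mul_assoc)
  with assms have "orth_projector (mat 1 - (mat 1 - A) ** (mat 1 - B))"
    by (intro orth_projector_compl orth_projector_mult)
  also have "mat 1 - (mat 1 - A) ** (mat 1 - B) = A + B - A ** B"
    by (simp add: matrix_eq matrix_vector_mult_diff_rdistrib matrix_vector_mult_diff_distrib
        matrix_vector_mult_add_rdistrib flip: matrix_vector_mul_assoc)
  finally show ?thesis .
qed

text \<open>Since \<open>fixed_space A\<close> is the range of \<open>A\<close>, self-adjointness
  turns orthogonality to it into \<open>A *v x\<close> being orthogonal to every vector. By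
  nondegeneracy \<open>A *v x = 0\<close>, that is, \<open>mat 1 - A\<close> fixes
  \<open>x\<close>.\<close>

lemma orth_compl_fixed_space:
  assumes "orth_projector A"
  shows "orth_compl (fixed_space A) = fixed_space (mat 1 - A)"
proof -
  have "A *v (A *v y) = A *v y" for y
    using assms by (simp add: orth_projector_def matrix_vector_mul_assoc)
  then have "fixed_space A = range ((*v) A)"
    by (auto simp: fixed_space_def) (metis rangeI)
  then have "x \<in> orth_compl (fixed_space A) \<longleftrightarrow> A *v x = 0" for x
    using assms by (simp add: orth_compl_def orth_projector_def flip: std_inner_eq_zero_iff)
  then show ?thesis
    by (auto simp: fixed_space_def matrix_vector_mult_diff_rdistrib)
qed

lemma fixed_space_mult:
  assumes "A ** A = A" "B ** B = B" and comm: "A ** B = B ** A"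
  shows "fixed_space (A ** B) = fixed_space A \<inter> fixed_space B"
proof (intro equalityI subsetI)
  fix x assume "x \<in> fixed_space (A ** B)"
  then have x: "(A ** B) *v x = x"
    by (simp add: fixed_space_def)
  \<comment> \<open>Both factors act as the identity on the range of the product; this gives the
    nontrivial inclusion.\<close>
  have "A ** (A ** B) = A ** B" "B ** (A ** B) = A ** B"
    using assms(1,2) by (metis comm matrix_mul_assoc)+
  with x have "A *v x = x" "B *v x = x"
    by (metis matrix_vector_mul_assoc)+
  then show "x \<in> fixed_space A \<inter> fixed_space B"
    by (simp add: fixed_space_def)
qed (auto simp: fixed_space_def simp flip: matrix_vector_mul_assoc)

lemma fixed_space_join:
  assumes "A ** A = A" "B ** B = B" and comm: "A ** B = B ** A"
  shows "fixed_space (A + B - A ** B) =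
    {x + y | x y. x \<in> fixed_space A \<and> y \<in> fixed_space B}"
proof -
  have idem: "A *v (A *v x) = A *v x" "B *v (B *v x) = B *v x"
    and comm': "A *v (B *v x) = B *v (A *v x)" for x
    using assms by (simp_all add: matrix_vector_mul_assoc)
  \<comment> \<open>This form displays a fixed vector of the join as a sum of one vector from each
    range.\<close>
  have join: "(A + B - A ** B) *v x = A *v x + B *v (x - A *v x)" for x
    by (simp add: matrix_vector_mult_diff_rdistrib matrix_vector_mult_diff_distrib
        matrix_vector_mult_add_rdistrib comm' flip: matrix_vector_mul_assoc)
  show ?thesis
  proof (intro equalityI subsetI)
    fix x assume "x \<in> fixed_space (A + B - A ** B)"
    then have "x = A *v x + B *v (x - A *v x)"
      by (simp add: fixed_space_def join)
    moreover have "A *v x \<in> fixed_space A" "B *v (x - A *v x) \<in> fixed_space B"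
      by (simp_all add: fixed_space_def idem)
    ultimately show "x \<in> {x + y | x y. x \<in> fixed_space A \<and> y \<in> fixed_space B}"
      by blast
  next
    fix z assume "z \<in> {x + y | x y. x \<in> fixed_space A \<and> y \<in> fixed_space B}"
    then obtain x y where z: "z = x + y" and x: "A *v x = x" and y: "B *v y = y"
      by (auto simp: fixed_space_def)
    \<comment> \<open>By commutation \<open>A\<close> preserves the range of \<open>B\<close>, so
      \<open>B\<close> fixes \<open>y - A *v y\<close>, the remainder of \<open>z\<close> after
      applying \<open>A\<close>.\<close>
    have "B *v (A *v y) = A *v y"
      by (simp add: y flip: comm')
    with x y show "z \<in> fixed_space (A + B - A ** B)"
      by (simp add: fixed_space_def join z matrix_vector_right_distrib
          matrix_vector_mult_diff_distrib)
  qed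
qed

text \<open>The projector property is carried through the induction because the connective lemmas
  need idempotence and, for negation, self-adjointness of the values of subformulas.\<close>

lemma pba_value_imp_std_value:
  fixes v :: "nat \<Rightarrow> 'a::conjugatable_field ^ 'd ^ 'd"
  assumes "proj_valuation v" "pba_value v \<phi> = Some A"
  shows "orth_projector A \<and> std_value (\<lambda>i. fixed_space (v i)) \<phi> = fixed_space A"
  using assms(2)
proof (induction \<phi> arbitrary: A)
  case (Atom i)
  with assms(1) show ?case by (auto simp: proj_valuation_def)
next
  case (Neg \<phi>)
  then show ?case
    by (auto simp: orth_projector_compl orth_compl_fixed_space split: option.splits)
next
  case (Conj \<phi> \<psi>)
  then obtain B C where "pba_value v \<phi> = Some B" "pba_value v \<psi> = Some C"
    and "B ** C = C ** B" "A = B ** C"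
    by (auto split: option.splits if_splits)
  with Conj.IH show ?case
    by (simp add: orth_projector_mult)
       (metis fixed_space_mult orth_projector_def)
next
  case (Disj \<phi> \<psi>)
  then obtain B C where "pba_value v \<phi> = Some B" "pba_value v \<psi> = Some C"
    and comm: "B ** C = C ** B" and A: "A = B + C - B ** C"
    by (auto split: option.splits if_splits)
  with Disj.IH have B: "orth_projector B" "std_value (\<lambda>i. fixed_space (v i)) \<phi> = fixed_space B"
    and C: "orth_projector C" "std_value (\<lambda>i. fixed_space (v i)) \<psi> = fixed_space C"
    by blast+
  then have "fixed_space A = {x + y | x y. x \<in> fixed_space B \<and> y \<in> fixed_space C}"
    unfolding A by (intro fixed_space_join comm) (simp_all add: orth_projector_def)
  with B C show ?case
    using orth_projector_join[OF B(1) C(1) comm] by (simp add: A)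
qed

text \<open>Idempotence of the value turns \<open>A \<noteq> 0\<close> into a nontrivial range. The
  scalars stay generic, so the real and complex cases are both instances.\<close>

lemma sat_pba_imp_sat_std:
  assumes "sat_pba TYPE('a::conjugatable_field ^ 'd) \<phi>"
  shows "sat_std TYPE('a ^ 'd) \<phi>"
proof -
  obtain v :: "nat \<Rightarrow> 'a ^ 'd ^ 'd" and A
    where v: "proj_valuation v" "pba_value v \<phi> = Some A" and "A \<noteq> 0"
    using assms by (auto simp: sat_pba_def)
  then have "std_value (\<lambda>i. fixed_space (v i)) \<phi> \<noteq> {0}"
    using pba_value_imp_std_value[OF v] by (simp add: fixed_space_eq_zero_iff orth_projector_def)
  then show ?thesis
    unfolding sat_std_def std_valuation_def
    by (intro exI[of _ "\<lambda>i. fixed_space (v i)"] conjI allI subspace_fixed_space)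
qed

theorem mainTheorem3:
  fixes \<phi> :: form
  shows "(sat_pba TYPE(real ^ 'd::finite) \<phi> \<longrightarrow> sat_std TYPE(real ^ 'd) \<phi>) \<and>
         (sat_pba TYPE(complex ^ 'd) \<phi> \<longrightarrow> sat_std TYPE(complex ^ 'd) \<phi>)"
  by (simp add: sat_pba_imp_sat_std)

end
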